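(* Let $k\ge 1$ and let $n_1,\dots,n_k$ be positive integers. Then there exists an interval partition of the poset $\llbracket n_1,n_2,\dots,n_k\rrbracket$ that is both optimal and good; that is, there is an interval partition $\pi^*$ of $\llbracket n_1,\dots,n_k\rrbracket$ with $\operatorname{tdepth}\pi^*=\operatorname{tdepth}\llbracket n_1,\dots,n_k\rrbracket$ such that each interval in $\pi^*$ has the form $[X,(n_1y_1,\dots,n_ky_k)]$ with $X\in\{0,1\}^k$ and $Y=(y_1,\dots,y_k)\in\{0,1\}^k$.
   Context: For positive integers $n_1,\dots,n_k$, let $\llbracket n_1,\dots,n_k\rrbracket$ denote the poset of nonempty submultisets of the multiset $S=\{1^{n_1},\dots,k^{n_k}\}$ ordered by inclusion; equivalently, the set of nonzero tuples $(a_1,\dots,a_k)$ of integers with $0\le a_j\le n_j$ for all $j$, ordered componentwise. An interval in a finite poset $P$ is a set $[X,Y]=\{Z\in P: X\le Z\le Y\}$ with $X\le Y$ in $P$; $X$ is its bottom element and $Y$ its top element. An interval partition of $P$ is a partition of $P$ into nonempty pairwise disjoint intervals. The height of $Z\in P$ is the maximal size $n$ of a chain $Z=Z_1>Z_2>\cdots>Z_n$ in $P$ (in $\llbracket n_1,\dots,n_k\rrbracket$ the height of $(z_1,\dots,z_k)$ is $z_1+\cdots+z_k$). The total depth of an interval partition $\pi$ is $\operatorname{tdepth}\pi=\min_{[X,Y]\in\pi}\operatorname{height}Y$, and the total depth of $P$ is $\operatorname{tdepth}P=\max_\pi\operatorname{tdepth}\pi$ over all interval partitions $\pi$ of $P$.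 An interval partition $\pi$ of $P$ is optimal if $\operatorname{tdepth}\pi=\operatorname{tdepth}P$. *)

theory Defs
  imports Main "HOL-Library.FuncSet" "HOL-Library.Disjoint_Sets"
begin

text \<open>
  A finite poset is a finite set \<open>P\<close> of elements of an ordered type, with the induced order.
\<close>

definition poset_interval :: "'a::order set \<Rightarrow> 'a \<Rightarrow> 'a \<Rightarrow> 'a set" where
  "poset_interval P X Y = {Z \<in> P. X \<le> Z \<and> Z \<le> Y}"

text \<open>
  The end points are required to be elements of \<open>P\<close>, so that they are determined by the interval
  as a set.
\<close>

definition is_interval_of :: "'a::order set \<Rightarrow> 'a \<Rightarrow> 'a \<Rightarrow> 'a set \<Rightarrow> bool" where
  "is_interval_of P X Y I \<longleftrightarrow> X \<in> P \<and> Y \<in> P \<and> X \<le> Y \<and> I = poset_interval P X Y"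

definition interval_partition :: "'a::order set \<Rightarrow> 'a set set \<Rightarrow> bool" where
  "interval_partition P \<pi> \<longleftrightarrow> partition_on P \<pi> \<and> (\<forall>I\<in>\<pi>. \<exists>X Y. is_interval_of P X Y I)"

text \<open>
  A chain \<open>Z = Z\<^sub>1 > \<dots> > Z\<^sub>n\<close> is a strictly decreasing list with head \<open>Z\<close>, and its size is its length.
  The \<open>Max\<close> and \<open>Min\<close> below range over finite nonempty sets whenever \<open>P\<close> is finite and nonempty,
  \<open>Z \<in> P\<close>, and \<open>\<pi>\<close> is an interval partition of \<open>P\<close>; otherwise they are not meaningful.
\<close>

definition height :: "'a::order set \<Rightarrow> 'a \<Rightarrow> nat" where
  "height P Z = Max {length zs | zs. zs \<noteq> [] \<and> hd zs = Z \<and> set zs \<subseteq> P \<and> sorted_wrt (>) zs}"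

definition tdepth_partition :: "'a::order set \<Rightarrow> 'a set set \<Rightarrow> nat" where
  "tdepth_partition P \<pi> = Min {height P Y | X Y I. I \<in> \<pi> \<and> is_interval_of P X Y I}"

definition tdepth :: "'a::order set \<Rightarrow> nat" where
  "tdepth P = Max {tdepth_partition P \<pi> | \<pi>. interval_partition P \<pi>}"

definition optimal :: "'a::order set \<Rightarrow> 'a set set \<Rightarrow> bool" where
  "optimal P \<pi> \<longleftrightarrow> interval_partition P \<pi> \<and> tdepth_partition P \<pi> = tdepth P"

text \<open>
  The poset of nonempty submultisets of the multiset in which each \<open>j \<in> {1..k}\<close> occurs \<open>n j\<close>
  times, as nonzero tuples \<open>(a 1, \<dots>, a k)\<close>
  with \<open>0 \<le> a j \<le> n j\<close>. Tuples are extensional functions on \<open>{1..k}\<close>: they all take the same value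
  outside \<open>{1..k}\<close>, so the library's pointwise order on functions compares exactly the \<open>k\<close> components.
\<close>

definition multiset_poset :: "nat \<Rightarrow> (nat \<Rightarrow> nat) \<Rightarrow> (nat \<Rightarrow> nat) set" where
  "multiset_poset k n = {a \<in> (\<Pi>\<^sub>E j\<in>{1..k}. {0..n j}). \<exists>j\<in>{1..k}. a j \<noteq> 0}"

definition good :: "nat \<Rightarrow> (nat \<Rightarrow> nat) \<Rightarrow> (nat \<Rightarrow> nat) set set \<Rightarrow> bool" where
  "good k n \<pi> \<longleftrightarrow>
     (\<forall>I\<in>\<pi>. \<exists>X \<in> {1..k} \<rightarrow>\<^sub>E {0, 1}. \<exists>y \<in> {1..k} \<rightarrow>\<^sub>E {0, 1}.
        is_interval_of (multiset_poset k n) X (\<lambda>j\<in>{1..k}. n j * y j) I)"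

end

theory Submission imports Defs begin

text \<open>
  Call a tuple binary if its entries are at most \<open>1\<close>, and let the support indicator of \<open>Z\<close> be the
  binary tuple \<open>j \<mapsto> min (Z j) 1\<close>. A good interval \<open>[X, n \<cdot> y]\<close> is the set of all \<open>Z\<close> whose support
  indicator lies between \<open>X\<close> and \<open>y\<close>, so good interval partitions are the preimages, under the
  support indicator, of interval partitions of the poset of nonzero binary tuples.

  An arbitrary interval partition \<open>\<pi>\<close> restricts to one of the latter: an interval \<open>[X, Y]\<close> either
  contains no binary tuple or meets the binary tuples in the interval from \<open>X\<close> to the support
  indicator of \<open>Y\<close>. Pulling back, the interval with top \<open>Y\<close> becomes one whose top is \<open>n j\<close> wherever
  \<open>Y j \<noteq> 0\<close> and \<open>0\<close> elsewhere (\<open>preimage_interval\<close>). This top is above \<open>Y\<close>. Heights are monotone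
  (\<open>height_mono\<close>), so no top gets lower and the total depth cannot decrease. Applied to an
  optimal \<open>\<pi>\<close>, the construction therefore gives a partition that is optimal and good.
\<close>

section \<open>Heights and optimal partitions of a finite poset\<close>

lemma finite_chain_lengths:
  assumes "finite P"
  shows "finite {length zs | zs. zs \<noteq> [] \<and> hd zs = Z \<and> set zs \<subseteq> P \<and> sorted_wrt (>) (zs::'a::order list)}"
proof (rule finite_subset)
  show "{length zs | zs. zs \<noteq> [] \<and> hd zs = Z \<and> set zs \<subseteq> P \<and> sorted_wrt (>) zs} \<subseteq> {..card P}"
  proof clarsimp
    fix zs :: "'a list" assume "set zs \<subseteq> P" "sorted_wrt (>) zs"
    then have "distinct zs"
      by (induction zs) auto
    then show "length zs \<le> card P"
      using \<open>set zs \<subseteq> P\<close> assms by (metis card_mono distinct_card)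
  qed
qed simp

text \<open>A chain that starts at \<open>Y\<close> stays a chain when its head is replaced by a larger element.\<close>

lemma height_mono:
  fixes P :: "'a::order set"
  assumes "finite P" "Y \<in> P" "Y' \<in> P" "Y \<le> Y'"
  shows "height P Y \<le> height P Y'"
proof -
  let ?L = "\<lambda>Z. {length zs | zs. zs \<noteq> [] \<and> hd zs = Z \<and> set zs \<subseteq> P \<and> sorted_wrt (>) zs}"
  have "?L Y \<subseteq> ?L Y'"
  proof
    fix m assume "m \<in> ?L Y"
    then obtain zs where zs: "m = length zs" "zs \<noteq> []" "hd zs = Y" "set zs \<subseteq> P" "sorted_wrt (>) zs"
      by auto
    then obtain ws where ws: "zs = Y # ws"
      by (cases zs) auto
    have "Y' > x" if "x \<in> set ws" for x
      using zs(5) ws that less_le_trans[OF _ assms(4)] by simp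
    then have "sorted_wrt (>) (Y' # ws)" "set (Y' # ws) \<subseteq> P" "m = length (Y' # ws)"
      using zs(1,4,5) ws assms(3) by simp_all
    then show "m \<in> ?L Y'"
      by (intro CollectI exI[of _ "Y' # ws"]) simp
  qed
  moreover have "length [Y] \<in> ?L Y"
    using assms(2) by (intro CollectI exI[of _ "[Y]"]) simp
  then have "?L Y \<noteq> {}"
    by blast
  ultimately show ?thesis
    unfolding height_def using finite_chain_lengths[OF assms(1)] by (rule Max_mono)
qed

lemma interval_endpoints_unique:
  assumes "is_interval_of P X Y I" "is_interval_of P X' Y' I"
  shows "X = X'" "Y = Y'"
proof -
  have I: "I = poset_interval P X Y" and I': "I = poset_interval P X' Y'"
    using assms by (simp_all only: is_interval_of_def)
  have "X \<in> I" "Y \<in> I"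
    using assms(1) unfolding I is_interval_of_def poset_interval_def by simp_all
  then have "X' \<le> X" "Y \<le> Y'"
    unfolding I' poset_interval_def by simp_all
  moreover have "X' \<in> I" "Y' \<in> I"
    using assms(2) unfolding I' is_interval_of_def poset_interval_def by simp_all
  then have "X \<le> X'" "Y' \<le> Y"
    unfolding I poset_interval_def by simp_all
  ultimately show "X = X'" "Y = Y'"
    by (simp_all add: order.antisym)
qed

lemma finite_interval_heights:
  assumes "finite P"
  shows "finite {height P Y | X Y I. I \<in> \<pi> \<and> is_interval_of P X Y I}"
  by (rule finite_subset[of _ "height P ` P"]) (auto simp: assms is_interval_of_def)

lemma finite_tdepths:
  assumes "finite P"
  shows "finite {tdepth_partition P \<pi> | \<pi>. interval_partition P \<pi>}"
proof (rule finite_subset)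
  show "{tdepth_partition P \<pi> | \<pi>. interval_partition P \<pi>} \<subseteq> tdepth_partition P ` Pow (Pow P)"
    unfolding interval_partition_def partition_on_def by blast
qed (simp add: assms)

text \<open>The partition into singletons shows that the maximum in \<open>tdepth\<close> is taken over a nonempty set.\<close>

lemma optimal_exists:
  fixes P :: "'a::order set"
  assumes "finite P"
  obtains \<pi> where "optimal P \<pi>"
proof -
  have "is_interval_of P x x {x}" if "x \<in> P" for x
    using that by (auto simp: is_interval_of_def poset_interval_def)
  then have "interval_partition P ((\<lambda>x. {x}) ` P)"
    unfolding interval_partition_def using partition_on_singletons by blast
  then have "{tdepth_partition P \<pi> | \<pi>. interval_partition P \<pi>} \<noteq> {}"
    by blast
  from Max_in[OF finite_tdepths[OF assms] this] show ?thesis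
    using that unfolding optimal_def tdepth_def by force
qed

text \<open>
  Optimality of \<open>\<pi>'\<close> only needs a lower bound on the heights of its tops, and by monotonicity
  such a bound is inherited from any top of \<open>\<pi>\<close> below.
\<close>

lemma optimal_if_tops_above:
  fixes P :: "'a::order set"
  assumes fin: "finite P" and ne: "P \<noteq> {}"
    and opt: "optimal P \<pi>" and part: "interval_partition P \<pi>'"
    and above: "\<And>X' Y' I'. \<lbrakk>I' \<in> \<pi>'; is_interval_of P X' Y' I'\<rbrakk>
      \<Longrightarrow> \<exists>X Y I. I \<in> \<pi> \<and> is_interval_of P X Y I \<and> Y \<le> Y'"
  shows "optimal P \<pi>'"
proof -
  have "\<pi>' \<noteq> {}"
    using part ne by (auto simp: interval_partition_def partition_on_def)
  then have ne': "{height P Y | X Y I. I \<in> \<pi>' \<and> is_interval_of P X Y I} \<noteq> {}"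
    using part unfolding interval_partition_def by blast
  have "tdepth_partition P \<pi> \<le> height P Y'" if I': "I' \<in> \<pi>'" "is_interval_of P X' Y' I'" for X' Y' I'
  proof -
    obtain X Y I where I: "I \<in> \<pi>" "is_interval_of P X Y I" "Y \<le> Y'"
      using above[OF I'] by blast
    have "tdepth_partition P \<pi> \<le> height P Y"
      unfolding tdepth_partition_def
      by (rule Min_le[OF finite_interval_heights[OF fin]]) (use I in blast)
    also have "\<dots> \<le> height P Y'"
      using I I' by (intro height_mono[OF fin]) (auto simp: is_interval_of_def)
    finally show ?thesis .
  qed
  then have "tdepth_partition P \<pi> \<le> tdepth_partition P \<pi>'"
    unfolding tdepth_partition_def[of P \<pi>']
    by (intro Min.boundedI[OF finite_interval_heights[OF fin] ne']) blast
  moreover have "tdepth_partition P \<pi>' \<le> tdepth P"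
    unfolding tdepth_def by (rule Max_ge[OF finite_tdepths[OF fin]]) (use part in blast)
  ultimately show ?thesis
    using opt part by (simp add: optimal_def)
qed

section \<open>Pulling back along the support indicator\<close>

definition support_indicator :: "nat \<Rightarrow> (nat \<Rightarrow> nat) \<Rightarrow> nat \<Rightarrow> nat" where
  "support_indicator k Z = (\<lambda>j\<in>{1..k}. min (Z j) 1)"

lemma support_indicator_binary: "support_indicator k Z \<in> {1..k} \<rightarrow>\<^sub>E {0, 1}"
  by (auto simp: support_indicator_def PiE_iff min_def)

lemma support_indicator_in_multiset_poset:
  assumes "\<And>j. j \<in> {1..k} \<Longrightarrow> n j \<ge> 1" "Z \<in> multiset_poset k n"
  shows "support_indicator k Z \<in> multiset_poset k n"
proof -
  obtain j where "j \<in> {1..k}" "Z j \<noteq> 0"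
    using assms(2) by (auto simp: multiset_poset_def)
  then have "\<exists>j\<in>{1..k}. support_indicator k Z j \<noteq> 0"
    by (intro bexI[of _ j]) (simp_all add: support_indicator_def)
  moreover have "support_indicator k Z j \<in> {0..n j}" if "j \<in> {1..k}" for j
    using assms(1)[OF that] that by (simp add: support_indicator_def min.coboundedI2)
  ultimately show ?thesis
    by (simp add: multiset_poset_def PiE_iff) (simp add: support_indicator_def)
qed

lemma extensional_le_iff:
  assumes "A \<in> {1..k} \<rightarrow>\<^sub>E S" "B \<in> {1..k} \<rightarrow>\<^sub>E T"
  shows "A \<le> B \<longleftrightarrow> (\<forall>j\<in>{1..k}. A j \<le> (B j :: nat))"
proof -
  have "A j \<le> B j" if "j \<notin> {1..k}" for j
    using PiE_arb[OF assms(1) that] PiE_arb[OF assms(2) that] by simp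
  then show ?thesis
    unfolding le_fun_def by blast
qed

lemma partition_on_preimage:
  assumes "partition_on P \<pi>" "f ` P \<subseteq> P"
  shows "partition_on P ((\<lambda>I. {Z \<in> P. f Z \<in> I}) ` \<pi> - {{}})"
proof (rule partition_onI)
  show "\<Union> ((\<lambda>I. {Z \<in> P. f Z \<in> I}) ` \<pi> - {{}}) = P"
  proof (intro equalityI subsetI)
    fix Z assume "Z \<in> P"
    then obtain I where "I \<in> \<pi>" "f Z \<in> I"
      using partition_onD1[OF assms(1)] assms(2) by auto
    with \<open>Z \<in> P\<close> have "{Z \<in> P. f Z \<in> I} \<in> (\<lambda>I. {Z \<in> P. f Z \<in> I}) ` \<pi> - {{}}"
      and "Z \<in> {Z \<in> P. f Z \<in> I}"
      by auto
    then show "Z \<in> \<Union> ((\<lambda>I. {Z \<in> P. f Z \<in> I}) ` \<pi> - {{}})"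
      by (rule UnionI)
  qed auto
next
  fix p q
  assume "p \<in> (\<lambda>I. {Z \<in> P. f Z \<in> I}) ` \<pi> - {{}}" "q \<in> (\<lambda>I. {Z \<in> P. f Z \<in> I}) ` \<pi> - {{}}" "p \<noteq> q"
  then obtain I J where "p = {Z \<in> P. f Z \<in> I}" "q = {Z \<in> P. f Z \<in> J}" "I \<in> \<pi>" "J \<in> \<pi>" "I \<noteq> J"
    by auto
  moreover from this have "I \<inter> J = {}"
    using partition_onD2[OF assms(1)] by (auto dest: disjointD)
  ultimately show "disjnt p q"
    by (auto simp: disjnt_def)
qed auto

text \<open>
  If \<open>Z\<close> belongs to the preimage of \<open>[X, Y]\<close>, then \<open>X\<close> is below a binary tuple and hence binary. For
  binary \<open>X\<close>, being below \<open>Z\<close> and being below its support indicator are the same; and the support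
  indicator of \<open>Z\<close> is below \<open>Y\<close> iff \<open>Z\<close> vanishes wherever \<open>Y\<close> does, that is, iff \<open>Z\<close> is below the
  largest tuple with the support of \<open>Y\<close>.
\<close>

lemma preimage_interval:
  fixes k :: nat and n :: "nat \<Rightarrow> nat"
  defines "P \<equiv> multiset_poset k n"
  assumes pos: "\<And>j. j \<in> {1..k} \<Longrightarrow> n j \<ge> 1"
    and I: "is_interval_of P X Y I"
    and ne: "{Z \<in> P. support_indicator k Z \<in> I} \<noteq> {}"
  defines "T \<equiv> (\<lambda>j\<in>{1..k}. n j * support_indicator k Y j)"
  shows "X \<in> {1..k} \<rightarrow>\<^sub>E {0, 1}"
    and "is_interval_of P X T {Z \<in> P. support_indicator k Z \<in> I}"
    and "Y \<le> T"
proof -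
  have X: "X \<in> P" and Y: "Y \<in> P" and XY: "X \<le> Y" and I_eq: "I = {Z \<in> P. X \<le> Z \<and> Z \<le> Y}"
    using I by (auto simp: is_interval_of_def poset_interval_def)
  have in_PiE: "Z \<in> {1..k} \<rightarrow>\<^sub>E UNIV" and bound: "\<And>j. j \<in> {1..k} \<Longrightarrow> Z j \<le> n j" if "Z \<in> P" for Z
    using that by (auto simp: P_def multiset_poset_def)
  have T_PiE: "T \<in> {1..k} \<rightarrow>\<^sub>E UNIV" and s_PiE: "support_indicator k Z \<in> {1..k} \<rightarrow>\<^sub>E UNIV" for Z
    by (simp_all add: T_def support_indicator_def)
  have T_apply: "T j = (if Y j = 0 then 0 else n j)" if "j \<in> {1..k}" for j
    using that by (simp add: T_def support_indicator_def)
  have s_apply: "support_indicator k Z j = (if Z j = 0 then 0 else 1)" if "j \<in> {1..k}" for j Z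
    using that by (simp add: support_indicator_def)
  obtain W where "X \<le> support_indicator k W"
    using ne I_eq by blast
  then have X_le_1: "X j \<le> 1" if "j \<in> {1..k}" for j
    using s_apply[OF that, of W] by (auto simp: le_fun_def split: if_splits dest: spec[of _ j])
  then show "X \<in> {1..k} \<rightarrow>\<^sub>E {0, 1}"
    using in_PiE[OF X] by (force simp: PiE_iff le_Suc_eq)
  show "Y \<le> T"
    unfolding extensional_le_iff[OF in_PiE[OF Y] T_PiE] using T_apply bound[OF Y] by simp
  have "T \<in> P"
  proof -
    obtain j where "j \<in> {1..k}" "Y j \<noteq> 0"
      using Y by (auto simp: P_def multiset_poset_def)
    then have "\<exists>j\<in>{1..k}. T j \<noteq> 0"
      using T_apply[of j] pos[of j] by (intro bexI[of _ j]) auto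
    moreover have "T j \<in> {0..n j}" if "j \<in> {1..k}" for j
      using T_apply[OF that] by simp
    ultimately show ?thesis
      using T_PiE by (simp add: P_def multiset_poset_def PiE_iff)
  qed
  have "X \<le> support_indicator k Z \<longleftrightarrow> X \<le> Z" if "Z \<in> P" for Z
    unfolding extensional_le_iff[OF in_PiE[OF X] in_PiE[OF that]]
      extensional_le_iff[OF in_PiE[OF X] s_PiE]
  proof (intro ball_cong refl)
    fix j assume "j \<in> {1..k}"
    then show "X j \<le> support_indicator k Z j \<longleftrightarrow> X j \<le> Z j"
      using s_apply[of j Z] X_le_1[of j] by auto
  qed
  moreover have "support_indicator k Z \<le> Y \<longleftrightarrow> Z \<le> T" if "Z \<in> P" for Z
    unfolding extensional_le_iff[OF in_PiE[OF that] T_PiE]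
      extensional_le_iff[OF s_PiE in_PiE[OF Y]]
  proof (intro ball_cong refl)
    fix j assume "j \<in> {1..k}"
    then show "support_indicator k Z j \<le> Y j \<longleftrightarrow> Z j \<le> T j"
      using s_apply T_apply bound[OF that] by auto
  qed
  ultimately have "{Z \<in> P. support_indicator k Z \<in> I} = poset_interval P X T"
    using support_indicator_in_multiset_poset[OF pos]
    by (auto simp: I_eq poset_interval_def P_def)
  with X \<open>T \<in> P\<close> XY \<open>Y \<le> T\<close> show "is_interval_of P X T {Z \<in> P. support_indicator k Z \<in> I}"
    by (auto simp: is_interval_of_def)
qed

theorem theorem4p2:
  fixes k :: nat and n :: "nat \<Rightarrow> nat"
  assumes "k \<ge> 1"
    and "\<And>j. j \<in> {1..k} \<Longrightarrow> n j \<ge> 1"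
  shows "\<exists>\<pi>. interval_partition (multiset_poset k n) \<pi> \<and>
             optimal (multiset_poset k n) \<pi> \<and> good k n \<pi>"
proof -
  define P where "P = multiset_poset k n"
  define pre where "pre = (\<lambda>I. {Z \<in> P. support_indicator k Z \<in> I})"
  define max_of_support where "max_of_support = (\<lambda>Y. \<lambda>j\<in>{1..k}. n j * support_indicator k Y j)"
  have fin: "finite P"
    by (rule finite_subset[of _ "\<Pi>\<^sub>E j\<in>{1..k}. {0..n j}"])
      (auto simp: P_def multiset_poset_def intro: finite_PiE)
  have "(\<lambda>j\<in>{1..k}. n j) \<in> P"
    using assms by (force simp: P_def multiset_poset_def)
  then have "P \<noteq> {}"
    by blast
  obtain \<pi> where opt: "optimal P \<pi>"
    using optimal_exists[OF fin] .
  then have \<pi>: "partition_on P \<pi>" "\<And>I. I \<in> \<pi> \<Longrightarrow> \<exists>X Y. is_interval_of P X Y I"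
    by (auto simp: optimal_def interval_partition_def)
  define \<pi>' where "\<pi>' = pre ` \<pi> - {{}}"
  have part: "partition_on P \<pi>'"
    unfolding \<pi>'_def pre_def
    using support_indicator_in_multiset_poset[OF assms(2)]
    by (intro partition_on_preimage[OF \<pi>(1)]) (auto simp: P_def)
  have block: "\<exists>X Y I. I \<in> \<pi> \<and> is_interval_of P X Y I \<and> X \<in> {1..k} \<rightarrow>\<^sub>E {0, 1}
      \<and> is_interval_of P X (max_of_support Y) I' \<and> Y \<le> max_of_support Y" if "I' \<in> \<pi>'" for I'
  proof -
    obtain I where I: "I \<in> \<pi>" "I' = pre I" "pre I \<noteq> {}"
      using \<open>I' \<in> \<pi>'\<close> by (auto simp: \<pi>'_def)
    obtain X Y where XY: "is_interval_of P X Y I"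
      using \<pi>(2)[OF I(1)] by blast
    show ?thesis
      using preimage_interval[where k = k and n = n and X = X and Y = Y and I = I] assms(2) I XY
      unfolding P_def pre_def max_of_support_def by blast
  qed
  have intpart: "interval_partition P \<pi>'"
    using part block unfolding interval_partition_def by blast
  have "optimal P \<pi>'"
  proof (rule optimal_if_tops_above[OF fin \<open>P \<noteq> {}\<close> opt intpart])
    fix X' Y' I'
    assume "I' \<in> \<pi>'" "is_interval_of P X' Y' I'"
    \<comment> \<open>The total depth ranges over all representations of a block as an interval, so \<open>Y'\<close> has to be
      identified with the top that \<open>block\<close> provides.\<close>
    then show "\<exists>X Y I. I \<in> \<pi> \<and> is_interval_of P X Y I \<and> Y \<le> Y'"
      using block interval_endpoints_unique(2) by metis
  qed
  moreover have "good k n \<pi>'"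
    unfolding good_def
  proof
    fix I' assume "I' \<in> \<pi>'"
    from block[OF this] obtain X Y
      where "X \<in> {1..k} \<rightarrow>\<^sub>E {0, 1}" "is_interval_of P X (max_of_support Y) I'"
      by blast
    then show "\<exists>X \<in> {1..k} \<rightarrow>\<^sub>E {0, 1}. \<exists>y \<in> {1..k} \<rightarrow>\<^sub>E {0, 1}.
        is_interval_of (multiset_poset k n) X (\<lambda>j\<in>{1..k}. n j * y j) I'"
      unfolding P_def max_of_support_def
      by (intro bexI[OF _ \<open>X \<in> _\<close>] bexI[OF _ support_indicator_binary])
  qed
  ultimately show ?thesis
    using intpart unfolding P_def by blast
qed

end
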